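(* Consider the following two-player game. Fix integers $a,b$ (not necessarily positive) and a positive integer $n$. Two players $A$ and $B$ each start with a pile of $0$ chips (piles may become negative). They alternate turns, $A$ first; on each of his moves a player flips a fair coin, independently of everything else, to decide whether to add $a$ or $b$ chips to his own pile. The first player whose pile reaches at least $n$ chips wins. For a player, let $S_k$ be the number of chips in his pile after his $k$-th move ($S_0=0$), and let $q(n,k)=P(S_j<n \text{ for all } j=0,1,\dots,k)$ be the probability that he has not collected $n$ chips on or before his $k$-th move (so $q(n,0)=1$). Let $X$ be the number of moves (counted per player, i.e. the index $k$ of the round in which the game ends) required to end the game. Then the average duration of the game is \[ E[X]=\sum_{k=0}^{\infty} q(n,k)^2 . \]
   Context: The event that the game ends at the $k$-th turn has probability $q(n,k-1)r(n,k)+q(n,k)r(n,k)$, where $r(n,k)=P(S_k\ge n \text{ and } S_j<n \text{ for all } j=0,\dots,k-1)=q(n,k-1)-q(n,k)$ is the probability of collecting $n$ chips for the first time on the $k$-th move. *)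

theory Defs
  imports "HOL-Probability.Probability"
begin

datatype player = Player_A | Player_B

text \<open>
  The flip with index \<open>i\<close> decides a player's move number \<open>i + 1\<close>.  All flips are defined on the
  probability space, including those that are no longer used once the game has ended.
\<close>

locale fair_coin_flips = prob_space M for M :: "'w measure" +
  fixes flip :: "player \<Rightarrow> nat \<Rightarrow> 'w \<Rightarrow> bool"
  assumes indep_flips: "indep_vars (\<lambda>_. count_space UNIV) (\<lambda>(p, i). flip p i) UNIV"
    and fair_flips: "\<And>p i. prob {\<omega> \<in> space M. flip p i \<omega>} = 1 / 2"

definition pile :: "int \<Rightarrow> int \<Rightarrow> (player \<Rightarrow> nat \<Rightarrow> 'w \<Rightarrow> bool) \<Rightarrow> player \<Rightarrow> nat \<Rightarrow> 'w \<Rightarrow> int" where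
  "pile a b flip p k \<omega> = (\<Sum>i<k. if flip p i \<omega> then a else b)"

definition q ::
  "'w measure \<Rightarrow> int \<Rightarrow> int \<Rightarrow> (player \<Rightarrow> nat \<Rightarrow> 'w \<Rightarrow> bool) \<Rightarrow> player \<Rightarrow> int \<Rightarrow> nat \<Rightarrow> real" where
  "q M a b flip p n k = measure M {\<omega> \<in> space M. \<forall>j\<le>k. pile a b flip p j \<omega> < n}"

text \<open>
  Individual turns are numbered \<open>0, 1, 2, \<dots>\<close> and alternate between the players, starting with
  \<open>Player_A\<close>.  Turn \<open>t\<close> belongs to round \<open>t div 2 + 1\<close>, which is also the number of moves its
  mover has made once turn \<open>t\<close> is over.
\<close>

definition mover :: "nat \<Rightarrow> player" where
  "mover t = (if even t then Player_A else Player_B)"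

definition round_of :: "nat \<Rightarrow> nat" where
  "round_of t = t div 2 + 1"

definition reaches_goal ::
  "int \<Rightarrow> int \<Rightarrow> (player \<Rightarrow> nat \<Rightarrow> 'w \<Rightarrow> bool) \<Rightarrow> int \<Rightarrow> 'w \<Rightarrow> nat \<Rightarrow> bool" where
  "reaches_goal a b flip n \<omega> t \<longleftrightarrow> pile a b flip (mover t) (round_of t) \<omega> \<ge> n"

text \<open>The index of the round in which the game ends; infinite if the game never ends.\<close>

definition duration ::
  "int \<Rightarrow> int \<Rightarrow> (player \<Rightarrow> nat \<Rightarrow> 'w \<Rightarrow> bool) \<Rightarrow> int \<Rightarrow> 'w \<Rightarrow> enat" where
  "duration a b flip n \<omega> =
    (if \<exists>t. reaches_goal a b flip n \<omega> t
     then enat (round_of (LEAST t. reaches_goal a b flip n \<omega> t)) else \<infinity>)"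

end

theory Submission
  imports Defs
begin

text \<open>
  Round \<open>k\<close> leaves the game undecided exactly when neither player has reached the goal within
  \<open>k\<close> moves.  The two players use disjoint sets of independent, identically distributed flips, so
  this has probability \<open>(q M a b flip p n k)\<^sup>2\<close>, and \<open>E[X] = \<Sum>k. P(X > k)\<close>.
\<close>

text \<open>If \<open>x < y\<close>, then \<open>x\<close> is finite, so taking \<open>k\<close> to
  be \<open>x\<close> itself separates the two. This later expresses the event that the duration
  equals a given value through the events \<open>enat k < duration\<close>.\<close>

lemma enat_eqI_enat_less:
  assumes "\<And>k. enat k < x \<longleftrightarrow> enat k < y"
  shows "x = y"
proof (rule ccontr)
  assume "x \<noteq> y"
  then consider "x < y" | "y < x" by (rule linorder_neqE)
  then show False
  proof cases
    case 1
    then show False using assms by (cases x) auto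
  next
    case 2
    then show False using assms by (cases y) auto
  qed
qed

text \<open>Turns list the moves of both players in order of rounds, so the game outlasts round
  \<open>k\<close> iff no turn of a round up to \<open>k\<close> reaches the goal. This removes
  \<open>LEAST\<close> and the alternation of turns and leaves a condition on each pile
  separately.\<close>

lemma enat_less_duration_iff:
  assumes "n > 0"
  shows "enat k < duration a b flip n \<omega> \<longleftrightarrow> (\<forall>p. \<forall>j\<le>k. pile a b flip p j \<omega> < n)"
proof -
  have "enat k < duration a b flip n \<omega> \<longleftrightarrow>
        (\<forall>t. reaches_goal a b flip n \<omega> t \<longrightarrow> k < round_of t)"
  proof (cases "\<exists>t. reaches_goal a b flip n \<omega> t")
    case True
    define T where "T = (LEAST t. reaches_goal a b flip n \<omega> t)"
    have T: "reaches_goal a b flip n \<omega> T" "\<And>t. reaches_goal a b flip n \<omega> t \<Longrightarrow> T \<le> t"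
      unfolding T_def using True by (auto intro: LeastI_ex Least_le)
    \<comment> \<open>\<open>round_of\<close> is monotone, so the earliest winning turn also has the
      smallest round among all turns at which a pile is at the goal.\<close>
    have "round_of T \<le> round_of t" if "reaches_goal a b flip n \<omega> t" for t
      using T(2)[OF that] by (simp add: round_of_def div_le_mono)
    moreover have "duration a b flip n \<omega> = enat (round_of T)"
      using True by (simp add: duration_def T_def)
    ultimately show ?thesis using T(1) by (auto intro: less_le_trans)
  next
    case False
    then show ?thesis by (simp add: duration_def)
  qed
  also have "\<dots> \<longleftrightarrow> (\<forall>p. \<forall>j\<le>k. pile a b flip p j \<omega> < n)"
  proof safe
    fix p j
    assume *: "\<forall>t. reaches_goal a b flip n \<omega> t \<longrightarrow> k < round_of t" and "j \<le> k"
    show "pile a b flip p j \<omega> < n"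
    proof (cases j)
      case 0
      \<comment> \<open>No turn corresponds to \<open>j = 0\<close>; here the pile is the empty sum,
        and positivity of \<open>n\<close> is what is used.\<close>
      then show ?thesis using assms by (simp add: pile_def)
    next
      case (Suc i)
      \<comment> \<open>The turn at which \<open>p\<close> makes move number \<open>i + 1\<close>:
        even turns belong to \<open>Player_A\<close>, odd ones to \<open>Player_B\<close>.\<close>
      define t where "t = (case p of Player_A \<Rightarrow> 2 * i | Player_B \<Rightarrow> 2 * i + 1)"
      have "mover t = p" "round_of t = j"
        using Suc by (auto simp: t_def mover_def round_of_def split: player.split)
      then show ?thesis using * \<open>j \<le> k\<close> by (auto simp: reaches_goal_def not_le[symmetric])
    qed
  next
    fix t
    assume "\<forall>p. \<forall>j\<le>k. pile a b flip p j \<omega> < n" "reaches_goal a b flip n \<omega> t"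
    then show "k < round_of t" by (force simp: reaches_goal_def not_le[symmetric])
  qed
  finally show ?thesis .
qed

lemma UNIV_player: "(UNIV :: player set) = {Player_A, Player_B}"
  using player.exhaust by auto

text \<open>Induction on the number of summands. The partial sum takes values in the countable type
  \<open>int\<close>, so the step can be checked with that sum fixed at each constant
  \<open>s\<close>.\<close>

lemma measurable_sum_if:
  fixes f :: "'a \<Rightarrow> nat \<Rightarrow> bool" and a b :: int
  assumes [measurable]: "\<And>i. Measurable.pred N (\<lambda>x. f x i)"
  shows "(\<lambda>x. \<Sum>i<k. if f x i then a else b) \<in> N \<rightarrow>\<^sub>M count_space UNIV"
proof (induction k)
  case (Suc k)
  then have [measurable]: "(\<lambda>x. \<Sum>i<k. if f x i then a else b) \<in> N \<rightarrow>\<^sub>M count_space UNIV" .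
  have "(\<lambda>x. s + (if f x k then a else b)) \<in> N \<rightarrow>\<^sub>M count_space UNIV" for s
    by measurable
  then have "(\<lambda>x. (\<Sum>i<k. if f x i then a else b) + (if f x k then a else b)) \<in> N \<rightarrow>\<^sub>M count_space UNIV"
    by (rule measurable_compose_countable) measurable
  then show ?case by simp
qed simp

context fair_coin_flips
begin

lemma flip_measurable [measurable]: "flip p i \<in> M \<rightarrow>\<^sub>M count_space UNIV"
  using indep_flips unfolding indep_vars_def by (auto dest!: bspec[of _ _ "(p, i)"])

lemma pile_measurable [measurable]: "pile a b flip p k \<in> M \<rightarrow>\<^sub>M count_space UNIV"
  unfolding pile_def by (rule measurable_sum_if) measurable

text \<open>Two measures on \<open>bool\<close> agree once they agree on both singletons. Fairness
  gives the mass of \<open>True\<close>, and the complement gives that of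
  \<open>False\<close>.\<close>

lemma distr_flip: "distr M (count_space UNIV) (flip p i) = uniform_count_measure UNIV"
proof (rule measure_eqI_finite[of _ UNIV])
  fix c :: bool
  have "prob {\<omega> \<in> space M. flip p i \<omega> = c} = 1 / 2"
  proof (cases c)
    case False
    have "{\<omega> \<in> space M. flip p i \<omega>} \<in> events" by measurable
    from prob_compl[OF this] have "prob (space M - {\<omega> \<in> space M. flip p i \<omega>}) = 1 / 2"
      by (simp add: fair_flips)
    also have "space M - {\<omega> \<in> space M. flip p i \<omega>} = {\<omega> \<in> space M. flip p i \<omega> = c}"
      using False by auto
    finally show ?thesis .
  qed (simp add: fair_flips)
  moreover have "flip p i -` {c} \<inter> space M = {\<omega> \<in> space M. flip p i \<omega> = c}" by auto
  ultimately have "emeasure (distr M (count_space UNIV) (flip p i)) {c} = ennreal (1 / 2)"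
    by (simp only: emeasure_distr[OF flip_measurable] emeasure_eq_measure sets_count_space Pow_UNIV UNIV_I)
  also have "\<dots> = emeasure (uniform_count_measure UNIV) {c}"
    by (simp add: emeasure_uniform_count_measure)
  finally show "emeasure (distr M (count_space UNIV) (flip p i)) {c} =
      emeasure (uniform_count_measure UNIV) {c}" .
qed (auto simp: sets_uniform_count_measure)

text \<open>Independence makes the joint law of all flips a product of fair coins, and the flips of
  one player are the projection to the coordinates \<open>(p, i)\<close>. The resulting law does not
  mention \<open>p\<close>, which makes the players exchangeable.\<close>

lemma distr_player_flips:
  "distr M (\<Pi>\<^sub>M i\<in>UNIV. count_space UNIV) (\<lambda>\<omega> i. flip p i \<omega>) =
   (\<Pi>\<^sub>M i\<in>UNIV. uniform_count_measure UNIV)"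
proof -
  define U :: "bool measure" where "U = uniform_count_measure UNIV"
  \<comment> \<open>\<open>U\<close> and \<open>count_space UNIV\<close> are different measures with
    the same measurable sets; since \<open>distr\<close> and measurability depend only on the
    latter, the two can be exchanged as target spaces.\<close>
  have sets_U: "sets U = sets (count_space UNIV)"
    by (simp add: U_def sets_uniform_count_measure)
  have prob_U: "prob_space U"
    unfolding U_def by (rule prob_space_uniform_count_measure) auto
  have sets_PiM_U: "sets (\<Pi>\<^sub>M i\<in>I. U) = sets (\<Pi>\<^sub>M i\<in>I. count_space UNIV)" for I :: "'i set"
    by (intro sets_PiM_cong refl sets_U)
  have all_flips: "distr M (\<Pi>\<^sub>M x\<in>UNIV. count_space UNIV) (\<lambda>\<omega> (p, i). flip p i \<omega>) = (\<Pi>\<^sub>M x\<in>UNIV. U)"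
  proof -
    have "distr M (\<Pi>\<^sub>M x\<in>UNIV. count_space UNIV) (\<lambda>\<omega>. \<lambda>x\<in>UNIV. (case x of (p, i) \<Rightarrow> flip p i) \<omega>) =
        (\<Pi>\<^sub>M x\<in>UNIV. distr M (count_space UNIV) (case x of (p, i) \<Rightarrow> flip p i))"
      using indep_flips by (subst (asm) indep_vars_iff_distr_eq_PiM) (auto split: prod.split)
    also have "\<dots> = (\<Pi>\<^sub>M x\<in>UNIV. U)"
      by (intro PiM_cong refl) (auto simp: distr_flip U_def)
    finally show ?thesis by (simp add: restrict_UNIV case_prod_app)
  qed
  have "distr M (\<Pi>\<^sub>M i\<in>UNIV. count_space UNIV) (\<lambda>\<omega> i. flip p i \<omega>) =
      distr M (\<Pi>\<^sub>M i\<in>UNIV. U) (\<lambda>\<omega> i. flip p i \<omega>)"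
    by (intro distr_cong refl sets_PiM_U[symmetric])
  also have "\<dots> = distr (distr M (\<Pi>\<^sub>M x\<in>UNIV. count_space UNIV) (\<lambda>\<omega> (p, i). flip p i \<omega>))
        (\<Pi>\<^sub>M i\<in>UNIV. U) (\<lambda>g i. g (p, i))"
  proof (subst distr_distr)
    show "(\<lambda>g i. g (p, i)) \<in> (\<Pi>\<^sub>M x\<in>UNIV. count_space UNIV) \<rightarrow>\<^sub>M (\<Pi>\<^sub>M i\<in>UNIV. U)"
      by (subst measurable_cong_sets[OF refl sets_PiM_U]) (rule measurable_PiM_single', auto)
    show "(\<lambda>\<omega> (p, i). flip p i \<omega>) \<in> M \<rightarrow>\<^sub>M (\<Pi>\<^sub>M x\<in>UNIV. count_space UNIV)"
      by (rule measurable_PiM_single') (auto split: prod.split)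
  qed (simp add: comp_def)
  also have "\<dots> = (\<Pi>\<^sub>M i\<in>UNIV. U)"
    \<comment> \<open>Reindexing along the injection \<open>Pair p\<close> sends a product of copies
      of \<open>U\<close> to a product of copies of \<open>U\<close>.\<close>
    using distr_PiM_reindex[of UNIV "\<lambda>_. U" "Pair p" UNIV] prob_U
    by (simp add: all_flips inj_on_def restrict_UNIV)
  finally show ?thesis
    unfolding U_def .
qed

text \<open>A predicate on bare flip sequences, free of player and sample point, so that it can be
  evaluated under the law of a sequence and also composed with independent blocks of flips.\<close>

definition (in -) stays_below :: "int \<Rightarrow> int \<Rightarrow> int \<Rightarrow> nat \<Rightarrow> (nat \<Rightarrow> bool) \<Rightarrow> bool" where
  "stays_below a b n k f \<longleftrightarrow> (\<forall>j\<le>k. (\<Sum>i<j. if f i then a else b) < n)"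

lemma (in -) pred_stays_below:
  assumes "\<And>i. Measurable.pred N (\<lambda>x. f x i)"
  shows "Measurable.pred N (\<lambda>x. stays_below a b n k (f x))"
proof -
  note measurable_sum_if[OF assms, measurable]
  show ?thesis unfolding stays_below_def by measurable
qed

lemma q_eq_prob_stays_below:
  "q M a b flip p n k = prob {\<omega> \<in> space M. stays_below a b n k (\<lambda>i. flip p i \<omega>)}"
  by (simp add: q_def stays_below_def pile_def)

text \<open>Transfers the event to the space of flip sequences by \<open>distr_player_flips\<close>.
  The point is that \<open>p\<close> does not occur on the right, so \<open>q\<close> is the same
  for both players.\<close>

lemma q_eq_measure_PiM:
  "q M a b flip p n k = measure (\<Pi>\<^sub>M i\<in>UNIV. uniform_count_measure UNIV) {f. stays_below a b n k f}"
proof -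
  have "Measurable.pred (\<Pi>\<^sub>M i\<in>UNIV. count_space UNIV) (stays_below a b n k)"
    by (rule pred_stays_below) simp
  then have "{f. stays_below a b n k f} \<in> sets (\<Pi>\<^sub>M i\<in>UNIV. count_space UNIV)"
    by (simp add: pred_def space_PiM)
  moreover have "(\<lambda>\<omega> i. flip p i \<omega>) \<in> M \<rightarrow>\<^sub>M (\<Pi>\<^sub>M i\<in>UNIV. count_space UNIV)"
    by (rule measurable_PiM_single') auto
  ultimately have "measure (distr M (\<Pi>\<^sub>M i\<in>UNIV. count_space UNIV) (\<lambda>\<omega> i. flip p i \<omega>))
      {f. stays_below a b n k f} = prob ((\<lambda>\<omega> i. flip p i \<omega>) -` {f. stays_below a b n k f} \<inter> space M)"
    by (simp add: measure_distr)
  also have "(\<lambda>\<omega> i. flip p i \<omega>) -` {f. stays_below a b n k f} \<inter> space M =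
      {\<omega> \<in> space M. stays_below a b n k (\<lambda>i. flip p i \<omega>)}"
    by auto
  finally show ?thesis
    unfolding q_eq_prob_stays_below distr_player_flips by simp
qed

text \<open>The flips of the two players form disjoint blocks of one independent family, so
  functions of the separate blocks are independent and the probability factors.\<close>

lemma prob_both_below:
  "prob {\<omega> \<in> space M. \<forall>p. \<forall>j\<le>k. pile a b flip p j \<omega> < n} = (\<Prod>p\<in>UNIV. q M a b flip p n k)"
proof -
  define K where "K p = {p} \<times> (UNIV :: nat set)" for p :: player
  have "indep_vars (\<lambda>p. \<Pi>\<^sub>M x\<in>K p. count_space UNIV)
      (\<lambda>p \<omega>. restrict (\<lambda>x. (case x of (p, i) \<Rightarrow> flip p i) \<omega>) (K p)) UNIV"
    by (rule indep_vars_restrict[OF indep_flips]) (auto simp: disjoint_family_on_def K_def)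
  \<comment> \<open>Each block is mapped to the truth value of \<open>stays_below\<close>. Only
    coordinates \<open>(p, i)\<close> inside \<open>K p\<close> are read, so the restriction
    simplifies away afterwards.\<close>
  then have "indep_vars (\<lambda>p. count_space UNIV)
      (\<lambda>p \<omega>. stays_below a b n k (\<lambda>i. restrict (\<lambda>x. (case x of (p, i) \<Rightarrow> flip p i) \<omega>) (K p) (p, i))) UNIV"
  proof (rule indep_vars_compose2)
    fix p
    have [measurable]: "(\<lambda>g. g (p, i)) \<in> (\<Pi>\<^sub>M x\<in>K p. count_space UNIV) \<rightarrow>\<^sub>M count_space (UNIV :: bool set)" for i
      by (rule measurable_component_singleton) (simp add: K_def)
    show "(\<lambda>g. stays_below a b n k (\<lambda>i. g (p, i))) \<in> (\<Pi>\<^sub>M x\<in>K p. count_space UNIV) \<rightarrow>\<^sub>M count_space UNIV"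
      by (rule pred_stays_below) measurable
  qed
  then have indep: "indep_vars (\<lambda>p. count_space UNIV) (\<lambda>p \<omega>. stays_below a b n k (\<lambda>i. flip p i \<omega>)) UNIV"
    by (simp add: K_def)
  have "prob (\<Inter>p\<in>UNIV. (\<lambda>\<omega>. stays_below a b n k (\<lambda>i. flip p i \<omega>)) -` {True} \<inter> space M) =
      (\<Prod>p\<in>UNIV. prob ((\<lambda>\<omega>. stays_below a b n k (\<lambda>i. flip p i \<omega>)) -` {True} \<inter> space M))"
    by (rule indep_varsD[OF indep]) (auto simp: UNIV_player)
  moreover have "(\<Inter>p\<in>UNIV. (\<lambda>\<omega>. stays_below a b n k (\<lambda>i. flip p i \<omega>)) -` {True} \<inter> space M) =
      {\<omega> \<in> space M. \<forall>p. \<forall>j\<le>k. pile a b flip p j \<omega> < n}"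
    by (auto simp: stays_below_def pile_def)
  moreover have "(\<lambda>\<omega>. stays_below a b n k (\<lambda>i. flip p i \<omega>)) -` {True} \<inter> space M =
      {\<omega> \<in> space M. stays_below a b n k (\<lambda>i. flip p i \<omega>)}" for p
    by auto
  ultimately show ?thesis
    by (simp only: q_eq_prob_stays_below)
qed

end

theorem theorem4:
  fixes M :: "'w measure" and flip :: "player \<Rightarrow> nat \<Rightarrow> 'w \<Rightarrow> bool"
    and a b n :: int and p :: player
  assumes "fair_coin_flips M flip" and "n > 0"
  shows "(\<integral>\<^sup>+ \<omega>. ennreal_of_enat (duration a b flip n \<omega>) \<partial>M) =
         (\<Sum>k. ennreal ((q M a b flip p n k)\<^sup>2))"
proof -
  interpret fair_coin_flips M flip by fact
  have below: "{\<omega> \<in> space M. enat k < duration a b flip n \<omega>} =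
      {\<omega> \<in> space M. \<forall>p. \<forall>j\<le>k. pile a b flip p j \<omega> < n}" for k
    by (simp add: enat_less_duration_iff[OF \<open>n > 0\<close>])
  \<comment> \<open>The quantifier over players ranges over an explicit finite set so that
    \<open>measurable\<close> can treat it as a finite intersection.\<close>
  have "{\<omega> \<in> space M. \<forall>p\<in>{Player_A, Player_B}. \<forall>j\<le>k. pile a b flip p j \<omega> < n} \<in> events" for k
    by measurable
  then have events: "{\<omega> \<in> space M. enat k < duration a b flip n \<omega>} \<in> events" for k
    unfolding below by (simp flip: UNIV_player)
  have "duration a b flip n \<in> M \<rightarrow>\<^sub>M count_space UNIV"
  \<comment> \<open>As \<open>enat\<close> is countable, preimages of singletons suffice; each is a
    countable combination of the events \<open>enat k < duration\<close>.\<close>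
  proof (subst measurable_count_space_eq2_countable, safe)
    fix d :: enat
    have "duration a b flip n -` {d} \<inter> space M =
        {\<omega> \<in> space M. \<forall>k. enat k < duration a b flip n \<omega> \<longleftrightarrow> enat k < d}"
      by (auto intro: enat_eqI_enat_less)
    also have "\<dots> \<in> events"
      using events by measurable
    finally show "duration a b flip n -` {d} \<inter> space M \<in> events" .
  qed auto
  \<comment> \<open>The tail-sum formula for an \<open>enat\<close>-valued variable. It holds in
    \<open>ennreal\<close>, so games that never end, with duration \<infinity>, and an infinite
    expectation are covered.\<close>
  then have "(\<integral>\<^sup>+ \<omega>. ennreal_of_enat (duration a b flip n \<omega>) \<partial>M) =
      (\<Sum>k. emeasure M {\<omega> \<in> space M. enat k < duration a b flip n \<omega>})"
    by (rule nn_integral_enat_function)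
  also have "\<dots> = (\<Sum>k. ennreal ((q M a b flip p n k)\<^sup>2))"
  proof (rule suminf_cong)
    fix k
    \<comment> \<open>The product over the players has one factor for each of them; both must be
      turned into \<open>q\<close> for the fixed but arbitrary \<open>p\<close> of the claim to give
      a square.\<close>
    have q_player: "q M a b flip p' n k = q M a b flip p n k" for p'
      by (simp only: q_eq_measure_PiM)
    have "prob {\<omega> \<in> space M. enat k < duration a b flip n \<omega>} = (q M a b flip p n k)\<^sup>2"
      unfolding below prob_both_below
      by (simp add: UNIV_player power2_eq_square q_player[of Player_A] q_player[of Player_B])
    then show "emeasure M {\<omega> \<in> space M. enat k < duration a b flip n \<omega>} = ennreal ((q M a b flip p n k)\<^sup>2)"
      by (simp add: emeasure_eq_measure)
  qed
  finally show ?thesis .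
qed

end
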